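(* Let $(X,d)$ be a pseudo-complete ultrametric space with at least two points and without unpartnered points, and let $\mathfrak{P}(X)=\{[x_i] : i\in I\}$ be the set of (distinct) classes of partnered points under the relation of being partners. A set $S\subseteq X$ is a metric basis of $(X,d)$ if and only if there is $(\alpha_i)_{i\in I}\in\prod_{i\in I}[x_i]$ such that $S=\bigcup_{i\in I}\big([x_i]\smallsetminus\{\alpha_i\}\big)$.
   Context: A metric space $(X,d)$ is ultrametric if $d(x,y)\le\max\{d(x,z),d(z,y)\}$ for all $x,y,z\in X$. Points $x,y\in X$ are distinguished by $z\in X$ if $d(x,z)\neq d(y,z)$. A set $S\subseteq X$ is a metric generator for $X$ if any pair of different points of $X$ is distinguished by at least one element of $S$. A metric basis is a metric generator of minimum cardinality in $X$. Write $B_r(x)=\{p\in X: d(x,p)<r\}$, with $B_\infty(x)=X$. Two different points $x,y\in X$ are partners if $d(x,z)\ge d(x,y)$ and $d(y,z)\ge d(x,y)$ for all $z\in X\smallsetminus\{x,y\}$. A point $x$ is partnered if there is $y\in X$ such that $x,y$ are partners; $P(X)$ is the set of partnered points. A point $x$ is pseudopartnered if it is not partnered but there is $y\in X$, $y\ne x$, with $d(x,z)\ge d(x,y)$ for all $z\in X\smallsetminus\{x,y\}$. A point is unpartnered if it is neither partnered nor pseudopartnered. Being partners (together with equality) is an equivalence relation $\sim$ on $P(X)$; $\mathfrak{P}(X)=P(X)/\sim$ and $[x]=\{z\in X: x,z\text{ are partners}\}\cup\{x\}$ for $x\in P(X)$. Given a pseudopartnered point $x$, an $x$-pseudopartnering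 sequence $(x_n)_{n\ge 1}$ with associated distances $(d_n)_{n\ge1}$ is any sequence obtained inductively as follows: $x_1=x$, $d_1=\infty$. Given $x_n,d_n$: if $|B_{d_n}(x_n)|=1$ or $d_n=0$, put $x_{n+1}=x_n$, $d_{n+1}=0$. If $|B_{d_n}(x_n)|>1$, let $I_n=\{d(x_n,z): z\in B_{d_n}(x_n)\smallsetminus\{x_n\}\}$; if $I_n$ has no minimum put $x_{n+1}=x_n$, $d_{n+1}=0$; if $I_n$ has a minimum, choose any $x_{n+1}\in\{z\in X: d(x_n,z)=\min I_n\}$ and put $d_{n+1}=d(x_n,x_{n+1})$. A point $z\in X$ is a pseudolimit of a pseudopartnering sequence $(x_n)$ if $d(z,x_n)=d(x_n,x_{n+1})$ for every $n$. $(X,d)$ is pseudo-complete if for every pseudopartnered point $x\in X$: (i) every $x$-pseudopartnering sequence has a pseudolimit, and (ii) at least one $x$-pseudopartnering sequence has a finite number of pseudolimits.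
   Formalization: A metric basis is taken to be a metric generator of minimum cardinality none of whose proper subsets is a metric generator; this is automatic for finite S, but without it the claim fails, e.g. for S = X infinite with all nonzero distances 1. *)

theory Defs
  imports "HOL-Analysis.Analysis"
begin

locale ultrametric_space = Metric_space X d
  for X :: "'a set" and d :: "'a \<Rightarrow> 'a \<Rightarrow> real" +
  assumes ultrametric:
    "\<lbrakk>x \<in> X; y \<in> X; z \<in> X\<rbrakk> \<Longrightarrow> d x y \<le> max (d x z) (d z y)"

definition metric_generator :: "'a set \<Rightarrow> ('a \<Rightarrow> 'a \<Rightarrow> real) \<Rightarrow> 'a set \<Rightarrow> bool" where
  "metric_generator X d S \<longleftrightarrow>
     S \<subseteq> X \<and> (\<forall>x\<in>X. \<forall>y\<in>X. x \<noteq> y \<longrightarrow> (\<exists>z\<in>S. d x z \<noteq> d y z))"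

definition minimum_cardinality_generator ::
    "'a set \<Rightarrow> ('a \<Rightarrow> 'a \<Rightarrow> real) \<Rightarrow> 'a set \<Rightarrow> bool" where
  "minimum_cardinality_generator X d S \<longleftrightarrow>
     metric_generator X d S \<and> (\<forall>T. metric_generator X d T \<longrightarrow> S \<lesssim> T)"

text \<open>
  A metric basis is a metric generator of minimum cardinality, where the minimum is understood
  in the sense that no point of the basis is redundant. For finite generators the second
  conjunct below follows from the first (lemma \<open>metric_basis_finite_iff\<close>). For infinite
  ones it does not, because equality of cardinals does not notice redundant points: if X is an
  infinite set with all nonzero distances equal to 1, then X itself is a metric generator of
  minimum cardinality, although X minus any one point already generates.
\<close>

definition metric_basis :: "'a set \<Rightarrow> ('a \<Rightarrow> 'a \<Rightarrow> real) \<Rightarrow> 'a set \<Rightarrow> bool" where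
  "metric_basis X d S \<longleftrightarrow>
     minimum_cardinality_generator X d S \<and> (\<forall>T. T \<subset> S \<longrightarrow> \<not> metric_generator X d T)"

lemma metric_basis_finite_iff:
  assumes "finite S"
  shows "metric_basis X d S \<longleftrightarrow> minimum_cardinality_generator X d S"
proof -
  have "\<not> metric_generator X d T"
    if "minimum_cardinality_generator X d S" "T \<subset> S" for T
  proof
    assume "metric_generator X d T"
    with that have "S \<lesssim> T"
      by (simp add: minimum_cardinality_generator_def)
    moreover have "finite T"
      using that(2) assms by (meson finite_subset psubset_imp_subset)
    ultimately have "card S \<le> card T"
      by (simp add: assms lepoll_iff_card_le)
    with psubset_card_mono[OF assms that(2)] show False
      by simp
  qed
  then show ?thesis
    by (auto simp: metric_basis_def)
qed

definition partners :: "'a set \<Rightarrow> ('a \<Rightarrow> 'a \<Rightarrow> real) \<Rightarrow> 'a \<Rightarrow> 'a \<Rightarrow> bool" where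
  "partners X d x y \<longleftrightarrow>
     x \<in> X \<and> y \<in> X \<and> x \<noteq> y \<and> (\<forall>z \<in> X - {x, y}. d x z \<ge> d x y \<and> d y z \<ge> d x y)"

definition partnered :: "'a set \<Rightarrow> ('a \<Rightarrow> 'a \<Rightarrow> real) \<Rightarrow> 'a \<Rightarrow> bool" where
  "partnered X d x \<longleftrightarrow> (\<exists>y. partners X d x y)"

definition partnered_points :: "'a set \<Rightarrow> ('a \<Rightarrow> 'a \<Rightarrow> real) \<Rightarrow> 'a set" where
  "partnered_points X d = {x \<in> X. partnered X d x}"

definition pseudopartnered :: "'a set \<Rightarrow> ('a \<Rightarrow> 'a \<Rightarrow> real) \<Rightarrow> 'a \<Rightarrow> bool" where
  "pseudopartnered X d x \<longleftrightarrow>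
     x \<in> X \<and> \<not> partnered X d x \<and>
     (\<exists>y\<in>X. y \<noteq> x \<and> (\<forall>z \<in> X - {x, y}. d x z \<ge> d x y))"

definition unpartnered :: "'a set \<Rightarrow> ('a \<Rightarrow> 'a \<Rightarrow> real) \<Rightarrow> 'a \<Rightarrow> bool" where
  "unpartnered X d x \<longleftrightarrow>
     x \<in> X \<and> \<not> partnered X d x \<and> \<not> pseudopartnered X d x"

definition partner_class :: "'a set \<Rightarrow> ('a \<Rightarrow> 'a \<Rightarrow> real) \<Rightarrow> 'a \<Rightarrow> 'a set" where
  "partner_class X d x = {z \<in> X. partners X d x z} \<union> {x}"

definition partner_rel :: "'a set \<Rightarrow> ('a \<Rightarrow> 'a \<Rightarrow> real) \<Rightarrow> 'a rel" where
  "partner_rel X d =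
     {(x, y). x \<in> partnered_points X d \<and> y \<in> partnered_points X d \<and>
              (x = y \<or> partners X d x y)}"

definition partner_classes :: "'a set \<Rightarrow> ('a \<Rightarrow> 'a \<Rightarrow> real) \<Rightarrow> 'a set set" where
  "partner_classes X d = partnered_points X d // partner_rel X d"

text \<open>Unlike \<^const>\<open>Metric_space.mball\<close>, this admits the radius \<open>\<infinity>\<close>, for which it is X.\<close>

definition eball :: "'a set \<Rightarrow> ('a \<Rightarrow> 'a \<Rightarrow> real) \<Rightarrow> 'a \<Rightarrow> ereal \<Rightarrow> 'a set" where
  "eball X d x r = {p \<in> X. ereal (d x p) < r}"

definition is_minimum :: "real \<Rightarrow> real set \<Rightarrow> bool" where
  "is_minimum m A \<longleftrightarrow> m \<in> A \<and> (\<forall>t\<in>A. m \<le> t)"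

text \<open>
  One step from (x, r) to (x', r') of a pseudopartnering sequence. Since \<^const>\<open>card\<close> of an
  infinite set is 0, the first case is exactly the one where the ball is a singleton or r = 0;
  along a sequence the ball contains its centre unless r = 0, so otherwise it has at least two
  points.
\<close>

definition pseudopartnering_step ::
    "'a set \<Rightarrow> ('a \<Rightarrow> 'a \<Rightarrow> real) \<Rightarrow> 'a \<Rightarrow> ereal \<Rightarrow> 'a \<Rightarrow> ereal \<Rightarrow> bool" where
  "pseudopartnering_step X d x r x' r' \<longleftrightarrow>
     (if card (eball X d x r) = 1 \<or> r = 0 then x' = x \<and> r' = 0
      else let I = {d x z | z. z \<in> eball X d x r - {x}} in
        if \<exists>m. is_minimum m I
        then x' \<in> X \<and> is_minimum (d x x') I \<and> r' = ereal (d x x')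
        else x' = x \<and> r' = 0)"

text \<open>Sequences are indexed from 1; their values at 0 are irrelevant.\<close>

definition pseudopartnering_sequence ::
    "'a set \<Rightarrow> ('a \<Rightarrow> 'a \<Rightarrow> real) \<Rightarrow> 'a \<Rightarrow> (nat \<Rightarrow> 'a) \<Rightarrow> bool" where
  "pseudopartnering_sequence X d x xs \<longleftrightarrow>
     xs 1 = x \<and>
     (\<exists>ds :: nat \<Rightarrow> ereal. ds 1 = \<infinity> \<and>
       (\<forall>n\<ge>1. pseudopartnering_step X d (xs n) (ds n) (xs (n + 1)) (ds (n + 1))))"

definition pseudolimit :: "'a set \<Rightarrow> ('a \<Rightarrow> 'a \<Rightarrow> real) \<Rightarrow> (nat \<Rightarrow> 'a) \<Rightarrow> 'a \<Rightarrow> bool" where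
  "pseudolimit X d xs z \<longleftrightarrow> z \<in> X \<and> (\<forall>n\<ge>1. d z (xs n) = d (xs n) (xs (n + 1)))"

definition pseudo_complete :: "'a set \<Rightarrow> ('a \<Rightarrow> 'a \<Rightarrow> real) \<Rightarrow> bool" where
  "pseudo_complete X d \<longleftrightarrow>
     (\<forall>x. pseudopartnered X d x \<longrightarrow>
        (\<forall>xs. pseudopartnering_sequence X d x xs \<longrightarrow> (\<exists>z. pseudolimit X d xs z)) \<and>
        (\<exists>xs. pseudopartnering_sequence X d x xs \<and> finite {z. pseudolimit X d xs z}))"

end

theory Submission
  imports Defs
begin

text \<open>
  Two partners are equidistant from every third point, because an ultrametric triangle with a
  shortest side is isosceles over that side. Hence only x and y themselves distinguish a pair of
  partners x, y, and every metric generator omits at most one point of each class of partners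
  (\<open>generator_meets_partners\<close>).

  Conversely, a set that omits exactly one point of each class already generates
  (\<open>omits_one_generates\<close>). Let x and y be distinct. If neither has a point closer than the
  other one, they are partners and one of them lies in the set. Otherwise one of them, say x, has
  a nearest neighbour closer than y. Then the ball of radius d x y around x contains a pair of
  partners, one of which lies in the set; that point is closer to x than d x y, so its distance
  to y is exactly d x y, and it distinguishes x from y.

  The existence of these partners near x is the only place where pseudo-completeness enters
  (\<open>partners_near\<close>). If there were none, moving repeatedly to a nearest neighbour would
  give a pseudopartnering sequence that never stops and whose distances decrease strictly. Its
  pseudolimits are closed under passing to a nearest neighbour, and that passage too would
  strictly decrease the distance to the nearest neighbour. This is impossible in a nonempty finite
  set of pseudolimits.

  So the sets that omit exactly one point of each class are the minimal generators, every
  generator contains one of them, and all of them inject into every generator by exchanging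
  omitted points. They are therefore precisely the metric bases.
\<close>

section \<open>Nearest neighbours in ultrametric spaces\<close>

definition nearest_neighbour :: "'a set \<Rightarrow> ('a \<Rightarrow> 'a \<Rightarrow> real) \<Rightarrow> 'a \<Rightarrow> 'a \<Rightarrow> bool" where
  "nearest_neighbour X d x y \<longleftrightarrow> y \<in> X \<and> y \<noteq> x \<and> (\<forall>z\<in>X. z \<noteq> x \<longrightarrow> d x y \<le> d x z)"

definition omits_one_per_class :: "'a set \<Rightarrow> ('a \<Rightarrow> 'a \<Rightarrow> real) \<Rightarrow> 'a set \<Rightarrow> bool" where
  "omits_one_per_class X d S \<longleftrightarrow>
     S \<subseteq> partnered_points X d \<and>
     (\<forall>p\<in>partnered_points X d. \<exists>!a. a \<in> partner_class X d p \<and> a \<notin> S)"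

context ultrametric_space
begin

lemma isosceles:
  assumes "a \<in> X" "b \<in> X" "c \<in> X" "d a b < d b c"
  shows "d a c = d b c"
  using ultrametric[of a c b] ultrametric[of b c a] assms by (auto simp: commute)

lemma nearest_neighbour_le: "nearest_neighbour X d x y \<Longrightarrow> z \<in> X \<Longrightarrow> z \<noteq> x \<Longrightarrow> d x y \<le> d x z"
  by (auto simp: nearest_neighbour_def)

lemma nearest_neighbour_pos: "nearest_neighbour X d x y \<Longrightarrow> x \<in> X \<Longrightarrow> 0 < d x y"
  by (metis nearest_neighbour_def mdist_pos_less)

lemma partners_iff_nearest:
  "partners X d x y \<longleftrightarrow> x \<in> X \<and> nearest_neighbour X d x y \<and> nearest_neighbour X d y x"
  by (auto simp: partners_def nearest_neighbour_def commute)

text \<open>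
  If x is not itself nearest to y, then y has a point closer than x. This strict decrease is what
  drives both the sequences and the choice of a pseudolimit in \<open>partners_near\<close>.
\<close>

lemma nearest_distance_decreases:
  assumes "nearest_neighbour X d x y" "x \<in> X" "nearest_neighbour X d y z" "\<not> partners X d x y"
  shows "d y z < d x y"
proof (rule ccontr)
  assume "\<not> d y z < d x y"
  then have "nearest_neighbour X d y x"
    using assms by (fastforce simp: nearest_neighbour_def commute)
  with assms show False
    by (simp add: partners_iff_nearest)
qed

lemma has_nearest_neighbour:
  assumes "\<not> (\<exists>p. unpartnered X d p)" "x \<in> X"
  shows "\<exists>y. nearest_neighbour X d x y"
proof -
  have "partnered X d x \<or> pseudopartnered X d x"
    using assms by (auto simp: unpartnered_def)
  then show ?thesis
  proof
    assume "partnered X d x"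
    then show ?thesis
      by (auto simp: partnered_def partners_iff_nearest)
  next
    assume "pseudopartnered X d x"
    then obtain y where y: "y \<in> X" "y \<noteq> x" "\<forall>z \<in> X - {x, y}. d x z \<ge> d x y"
      by (auto simp: pseudopartnered_def)
    then have "d x y \<le> d x z" if "z \<in> X" "z \<noteq> x" for z
      using that by (cases "z = y") auto
    with y show ?thesis
      by (auto simp: nearest_neighbour_def)
  qed
qed

section \<open>Classes of partners\<close>

lemma partners_sym: "partners X d x y \<Longrightarrow> partners X d y x"
  by (auto simp: partners_iff_nearest nearest_neighbour_def)

text \<open>
  Partners x, y and y, z are at the same distance, the one from y to its nearest neighbours, and
  the ultrametric inequality bounds the distance of x and z by it.
\<close>

lemma partners_trans:
  assumes "partners X d x y" "partners X d y z" "x \<noteq> z"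
  shows "partners X d x z"
proof -
  have X: "x \<in> X" "y \<in> X" "z \<in> X"
    using assms by (auto simp: partners_def)
  have nn: "nearest_neighbour X d x y" "nearest_neighbour X d y x"
    "nearest_neighbour X d y z" "nearest_neighbour X d z y"
    using assms by (auto simp: partners_iff_nearest)
  have eq: "d x y = d y z"
    using nearest_neighbour_le[OF nn(2), of z] nearest_neighbour_le[OF nn(3), of x] nn X
    by (auto simp: nearest_neighbour_def commute)
  have xz: "d x z \<le> d x y" "d x z \<le> d z y"
    using ultrametric[of x z y] X eq commute[of y z] by simp_all
  have "nearest_neighbour X d x z"
    using X assms(3) xz(1) nearest_neighbour_le[OF nn(1)]
    by (fastforce simp: nearest_neighbour_def)
  moreover have "nearest_neighbour X d z x"
    using X assms(3) xz(2) nearest_neighbour_le[OF nn(4)]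
    by (fastforce simp: nearest_neighbour_def commute)
  ultimately show ?thesis
    using X by (simp add: partners_iff_nearest)
qed

lemma mem_partner_class: "q \<in> partner_class X d p \<longleftrightarrow> q = p \<or> partners X d p q"
  by (auto simp: partner_class_def partners_def)

lemma self_in_partner_class: "p \<in> partner_class X d p"
  by (simp add: mem_partner_class)

lemma partner_class_sym: "q \<in> partner_class X d p \<Longrightarrow> p \<in> partner_class X d q"
  using partners_sym[of p q] by (auto simp: mem_partner_class)

lemma partner_class_trans:
  "q \<in> partner_class X d p \<Longrightarrow> r \<in> partner_class X d q \<Longrightarrow> r \<in> partner_class X d p"
  using partners_trans[of p q r] by (auto simp: mem_partner_class)

lemma partner_class_eq: "q \<in> partner_class X d p \<Longrightarrow> partner_class X d q = partner_class X d p"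
  using partner_class_sym partner_class_trans by blast

lemma partners_in_class:
  assumes "a \<in> partner_class X d p" "b \<in> partner_class X d p" "a \<noteq> b"
  shows "partners X d a b"
  using partner_class_trans[OF partner_class_sym[OF assms(1)] assms(2)] assms(3)
  by (simp add: partner_class_def)

lemma partners_partnered:
  "partners X d p q \<Longrightarrow> p \<in> partnered_points X d \<and> q \<in> partnered_points X d"
  using partners_sym[of p q] by (auto simp: partnered_points_def partnered_def partners_iff_nearest)

lemma partner_class_partnered:
  "p \<in> partnered_points X d \<Longrightarrow> q \<in> partner_class X d p \<Longrightarrow> q \<in> partnered_points X d"
  using partners_partnered[of p q] by (auto simp: mem_partner_class)

lemma partner_classes_eq: "partner_classes X d = partner_class X d ` partnered_points X d"
proof -
  have "partner_rel X d `` {p} = partner_class X d p" if "p \<in> partnered_points X d" for p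
    using that partner_class_partnered[OF that]
    by (auto simp: partner_rel_def partner_class_def partners_def)
  then show ?thesis
    by (auto simp: partner_classes_def quotient_def)
qed

section \<open>Partners near a point\<close>

text \<open>
  By induction, the ball of the current radius always contains a nearest neighbour of the current
  point: the first ball is the whole space, and later on the current point would otherwise be a
  partner of its predecessor. Hence the sequence
  never stops, and the minimum that governs each step is the distance to a nearest neighbour. The
  points cannot leave the closed ball of radius d x y around x, as no step is longer than d x y;
  that is why it suffices to exclude partners from this ball.
\<close>

lemma pseudopartnering_sequence_nearest:
  assumes seq: "pseudopartnering_sequence X d x xs" and x: "x \<in> X"
    and unp: "\<not> (\<exists>p. unpartnered X d p)"
    and near: "nearest_neighbour X d x y"
    and none: "\<And>p q. partners X d p q \<Longrightarrow> \<not> d x p \<le> d x y"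
    and n: "n \<ge> 1"
  shows "xs n \<in> X \<and> d x (xs n) \<le> d x y \<and> nearest_neighbour X d (xs n) (xs (n + 1))"
proof -
  obtain ds where xs1: "xs 1 = x" and ds1: "ds 1 = \<infinity>" and
    step: "\<And>n. n \<ge> 1 \<Longrightarrow> pseudopartnering_step X d (xs n) (ds n) (xs (n + 1)) (ds (n + 1))"
    using seq by (auto simp: pseudopartnering_sequence_def)
  have y0: "0 < d x y"
    using near x by (rule nearest_neighbour_pos)
  have *: "nearest_neighbour X d (xs n) (xs (n + 1)) \<and> ds (n + 1) = ereal (d (xs n) (xs (n + 1)))"
    if n: "n \<ge> 1" and X: "xs n \<in> X" and w: "nearest_neighbour X d (xs n) w"
      and lt: "ereal (d (xs n) w) < ds n" for n w
  proof -
    define B where "B = eball X d (xs n) (ds n)"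
    define J where "J = {d (xs n) z |z. z \<in> B - {xs n}}"
    have w0: "0 < d (xs n) w"
      using w X by (rule nearest_neighbour_pos)
    have ds0: "0 < ds n"
      using lt w0 by (metis ereal_less(2) less_trans)
    have inB: "w \<in> B" "xs n \<in> B" "w \<noteq> xs n"
      using w lt X ds0 by (auto simp: B_def eball_def nearest_neighbour_def zero_ereal_def)
    have "card B \<noteq> 1"
      using inB by (metis card_1_singletonE singletonD)
    moreover have min: "is_minimum (d (xs n) w) J"
      using inB nearest_neighbour_le[OF w]
      by (auto simp: is_minimum_def J_def B_def eball_def)
    ultimately have new: "xs (n + 1) \<in> X" "is_minimum (d (xs n) (xs (n + 1))) J"
        "ds (n + 1) = ereal (d (xs n) (xs (n + 1)))"
      using step[OF n] ds0 unfolding pseudopartnering_step_def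
      by (auto simp: Let_def B_def J_def split: if_splits)
    have "d (xs n) (xs (n + 1)) = d (xs n) w"
      using new(2) min by (auto simp: is_minimum_def intro: antisym)
    then have "nearest_neighbour X d (xs n) (xs (n + 1))"
      using w w0 new(1) X by (auto simp: nearest_neighbour_def)
    with new(3) show ?thesis by simp
  qed
  have "xs n \<in> X \<and> d x (xs n) \<le> d x y \<and> nearest_neighbour X d (xs n) (xs (n + 1))
      \<and> d (xs n) (xs (n + 1)) \<le> d x y \<and> ds (n + 1) = ereal (d (xs n) (xs (n + 1)))"
    using n
  proof (induction n rule: dec_induct)
    case base
    have "nearest_neighbour X d (xs 1) (xs (1 + 1))"
        "ds (1 + 1) = ereal (d (xs 1) (xs (1 + 1)))"
      using *[of 1 y] near x xs1 ds1 by auto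
    moreover from this have "d x (xs (1 + 1)) \<le> d x y"
      using near xs1 by (simp add: nearest_neighbour_def)
    ultimately show ?case
      using x xs1 y0 by auto
  next
    case (step n)
    let ?a = "xs n" and ?b = "xs (n + 1)"
    have X: "?a \<in> X" "?b \<in> X"
      using step.IH by (auto simp: nearest_neighbour_def)
    have b: "d x ?b \<le> d x y"
      using ultrametric[of x ?b ?a] step.IH X x by auto
    obtain w where w: "nearest_neighbour X d ?b w"
      using has_nearest_neighbour[OF unp X(2)] by blast
    have "\<not> partners X d ?a ?b"
      using none partners_sym step.IH by blast
    then have lt: "d ?b w < d ?a ?b"
      using nearest_distance_decreases w X(1) step.IH by blast
    then have new: "nearest_neighbour X d ?b (xs (n + 1 + 1))"
        "ds (n + 1 + 1) = ereal (d ?b (xs (n + 1 + 1)))"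
      using *[of "n + 1" w] w X(2) step.IH by auto
    moreover have "d ?b (xs (n + 1 + 1)) \<le> d ?b w"
      using new(1) w by (auto simp: nearest_neighbour_def)
    ultimately show ?case
      using X b lt step.IH by auto
  qed
  then show ?thesis by blast
qed

text \<open>
  Without such partners, the distances to nearest neighbours decrease strictly along every
  pseudopartnering sequence from x. A pseudolimit z therefore has a nearest neighbour that is closer
  to z than any point of the sequence, and by isosceles triangles this neighbour is a pseudolimit
  as well. If there are finitely many pseudolimits, one whose nearest neighbour is at the least
  distance must be a partner of that neighbour, which is a contradiction as all pseudolimits are
  as close to x as its nearest neighbours are.
\<close>

lemma partners_near:
  assumes pc: "pseudo_complete X d" and unp: "\<not> (\<exists>p. unpartnered X d p)"
    and x: "x \<in> X" and near: "nearest_neighbour X d x y"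
  shows "\<exists>p q. partners X d p q \<and> d x p \<le> d x y \<and> d x q \<le> d x y"
proof (rule ccontr)
  assume no: "\<not> ?thesis"
  have none: "\<not> d x p \<le> d x y" if p: "partners X d p q" for p q
  proof
    assume le: "d x p \<le> d x y"
    have X: "p \<in> X" "q \<in> X" "p \<noteq> q" "nearest_neighbour X d p q"
      using p by (auto simp: partners_iff_nearest nearest_neighbour_def)
    have "d p q \<le> d x y"
    proof (cases "p = x")
      case True
      then show ?thesis
        using X near nearest_neighbour_le[of p q y] by (simp add: nearest_neighbour_def)
    next
      case False
      then show ?thesis
        using nearest_neighbour_le[OF X(4) x] le commute[of p x] by simp
    qed
    then have "d x q \<le> d x y"
      using ultrametric[of x q p] x X le by simp
    with no p le show False by blast
  qed
  have "\<not> partnered X d x"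
    using none[of x] nearest_neighbour_pos[OF near x] x by (auto simp: partnered_def)
  then have "pseudopartnered X d x"
    using unp x by (auto simp: unpartnered_def)
  then obtain xs where xs: "pseudopartnering_sequence X d x xs"
    and fin: "finite {z. pseudolimit X d xs z}" and ne: "\<exists>z. pseudolimit X d xs z"
    using pc unfolding pseudo_complete_def by blast
  have xs1: "xs 1 = x"
    using xs by (simp add: pseudopartnering_sequence_def)
  have seq: "xs n \<in> X \<and> d x (xs n) \<le> d x y \<and> nearest_neighbour X d (xs n) (xs (n + 1))"
    if "n \<ge> 1" for n
    using pseudopartnering_sequence_nearest[OF xs x unp near _ that] none by blast
  define nb where "nb z = (SOME w. nearest_neighbour X d z w)" for z
  have nb: "nearest_neighbour X d z (nb z)" if "z \<in> X" for z
    using has_nearest_neighbour[OF unp that] unfolding nb_def by (rule someI_ex)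
  have lim_near: "d x z \<le> d x y" if "pseudolimit X d xs z" for z
  proof -
    \<comment> \<open>The first condition on a pseudolimit puts it at the distance of the second point.\<close>
    have "d x z = d x (xs (1 + 1))"
      using that xs1 commute[of z x] by (auto simp: pseudolimit_def)
    then show ?thesis
      using seq[of 1] near xs1 by (auto simp: nearest_neighbour_def)
  qed
  have lim_nb: "pseudolimit X d xs (nb z)" if lim: "pseudolimit X d xs z" for z
  proof -
    have z: "z \<in> X" and dz: "\<And>n. n \<ge> 1 \<Longrightarrow> d z (xs n) = d (xs n) (xs (n + 1))"
      using lim by (auto simp: pseudolimit_def)
    have w: "nb z \<in> X" "nearest_neighbour X d z (nb z)"
      using nb[OF z] by (auto simp: nearest_neighbour_def)
    have "d (nb z) (xs n) = d (xs n) (xs (n + 1))" if n: "n \<ge> 1" for n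
    proof -
      let ?a = "xs n" and ?b = "xs (n + 1)"
      have a: "?a \<in> X" "nearest_neighbour X d ?a ?b" "d x ?a \<le> d x y"
        and b: "?b \<in> X" "nearest_neighbour X d ?b (xs (n + 2))"
        using seq[of n] seq[of "n + 1"] n by auto
      have "\<not> partners X d ?a ?b"
        using none a(3) by blast
      then have lt: "d ?b (xs (n + 2)) < d ?a ?b"
        using nearest_distance_decreases a b by blast
      \<comment> \<open>The condition at the next index makes the distance at z smaller than the current step.\<close>
      have "d z ?b = d ?b (xs (n + 2))"
        using dz[of "n + 1"] n by simp
      moreover from this have "z \<noteq> ?b"
        using nearest_neighbour_pos[OF b(2,1)] b by auto
      ultimately have "d z (nb z) \<le> d ?b (xs (n + 2))"
        using nearest_neighbour_le[OF w(2) b(1)] by auto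
      then have "d (nb z) z < d z ?a"
        using lt dz[OF n] commute[of z "nb z"] by simp
      then show ?thesis
        using isosceles[of "nb z" z ?a] w z a(1) dz[OF n] by simp
    qed
    with w show ?thesis
      by (simp add: pseudolimit_def)
  qed
  let ?Z = "{z. pseudolimit X d xs z}"
  obtain z where z: "z \<in> ?Z" and least: "\<And>w. w \<in> ?Z \<Longrightarrow> d z (nb z) \<le> d w (nb w)"
    using ex_is_arg_min_if_finite[OF fin, of "\<lambda>z. d z (nb z)"] ne
    unfolding is_arg_min_linorder by blast
  have zX: "z \<in> X" "nb z \<in> X"
    using z lim_nb by (auto simp: pseudolimit_def)
  have "\<not> partners X d z (nb z)"
    using none lim_near z by blast
  then have "d (nb z) (nb (nb z)) < d z (nb z)"
    using nearest_distance_decreases nb zX by blast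
  with least[of "nb z"] lim_nb z show False
    by auto
qed

section \<open>Generators and bases\<close>

text \<open>
  Every other point is too far away to distinguish two partners: it sees both at the same
  distance.
\<close>

lemma generator_meets_partners:
  assumes T: "metric_generator X d T" and p: "partners X d p q"
  shows "p \<in> T \<or> q \<in> T"
proof -
  have pq: "p \<in> X" "q \<in> X" "p \<noteq> q"
    using p by (auto simp: partners_def)
  then obtain z where z: "z \<in> T" "d p z \<noteq> d q z"
    using T unfolding metric_generator_def by blast
  then have zX: "z \<in> X"
    using T by (auto simp: metric_generator_def)
  have "z = p \<or> z = q"
  proof (rule ccontr)
    assume "\<not> (z = p \<or> z = q)"
    then have "d p q \<le> d p z" "d p q \<le> d q z"
      using p zX by (auto simp: partners_def)
    then have "d p z = d q z"
      using ultrametric[of p z q] ultrametric[of q z p] pq zX commute[of p q] by auto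
    with z show False by simp
  qed
  with z show ?thesis by auto
qed

lemma omits_one_meets_partners:
  assumes S: "omits_one_per_class X d S" and p: "partners X d p q"
  shows "p \<in> S \<or> q \<in> S"
proof -
  have "p \<in> partnered_points X d" "p \<in> partner_class X d p" "q \<in> partner_class X d p" "p \<noteq> q"
    using p partners_partnered by (auto simp: partner_class_def partners_def)
  then show ?thesis
    using S unfolding omits_one_per_class_def by blast
qed

lemma omits_one_generates:
  assumes pc: "pseudo_complete X d" and unp: "\<not> (\<exists>p. unpartnered X d p)"
    and S: "omits_one_per_class X d S"
  shows "metric_generator X d S"
proof -
  have SX: "S \<subseteq> X"
    using S by (auto simp: omits_one_per_class_def partnered_points_def)
  have closer: "\<exists>s\<in>S. d x s \<noteq> d y s"
    if xy: "x \<in> X" "y \<in> X" "nearest_neighbour X d x w" "d x w < d x y" for x y w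
  proof -
    obtain p q where pq: "partners X d p q" "d x p \<le> d x w" "d x q \<le> d x w"
      using partners_near[OF pc unp xy(1,3)] by blast
    then obtain s where s: "s \<in> S" "d x s \<le> d x w"
      using omits_one_meets_partners[OF S] by blast
    then have "d s y = d x y"
      using isosceles[of s x y] xy SX commute[of s x] by auto
    with s xy show ?thesis
      using commute[of s y] by (intro bexI[of _ s]) auto
  qed
  have "\<exists>s\<in>S. d x s \<noteq> d y s" if xy: "x \<in> X" "y \<in> X" "x \<noteq> y" for x y
  proof -
    obtain v w where v: "nearest_neighbour X d x v" and w: "nearest_neighbour X d y w"
      using has_nearest_neighbour[OF unp] xy by blast
    consider "d x v < d x y" | "d y w < d y x" | "d x y \<le> d x v" "d y x \<le> d y w"
      by linarith
    then show ?thesis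
    proof cases
      case 1
      then show ?thesis using closer v xy by blast
    next
      case 2
      then obtain s where "s \<in> S" "d y s \<noteq> d x s"
        using closer w xy by blast
      then show ?thesis by (metis)
    next
      case 3
      then have "nearest_neighbour X d x y" "nearest_neighbour X d y x"
        using v w xy by (auto simp: nearest_neighbour_def intro: order_trans)
      then have "x \<in> S \<or> y \<in> S"
        using omits_one_meets_partners[OF S] xy by (simp add: partners_iff_nearest)
      moreover have "d x x \<noteq> d y x" "d x y \<noteq> d y y"
        using xy by auto
      ultimately show ?thesis by blast
    qed
  qed
  with SX show ?thesis
    by (simp add: metric_generator_def)
qed

text \<open>
  A generator T contains all points of each class but at most one. If that one lies in S, it is
  exchanged for the point that S omits.
\<close>

lemma omits_one_lepoll_generator:
  assumes S: "omits_one_per_class X d S" and T: "metric_generator X d T"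
  shows "S \<lesssim> T"
proof -
  have SP: "p \<in> partnered_points X d" if "p \<in> S" for p
    using S that by (auto simp: omits_one_per_class_def)
  define a where "a p = (THE a. a \<in> partner_class X d p \<and> a \<notin> S)" for p
  have a: "a p \<in> partner_class X d p \<and> a p \<notin> S" if "p \<in> S" for p
  proof -
    have "\<exists>!a. a \<in> partner_class X d p \<and> a \<notin> S"
      using S SP[OF that] by (simp add: omits_one_per_class_def)
    then show ?thesis
      unfolding a_def by (rule theI')
  qed
  define f where "f p = (if p \<in> T then p else a p)" for p
  have "f p \<in> T" if p: "p \<in> S" for p
  proof (cases "p \<in> T")
    case False
    have "partners X d p (a p)"
      using a[OF p] p by (auto simp: mem_partner_class)
    then show ?thesis
      using generator_meets_partners[OF T] False by (auto simp: f_def)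
  qed (simp add: f_def)
  moreover have "p = q" if "p \<in> S" "q \<in> S" "f p = f q" for p q
  proof (cases "p \<in> T \<or> q \<in> T")
    case True
    then show ?thesis
      using that(3) a[OF that(1)] a[OF that(2)] that(1,2) by (auto simp: f_def split: if_splits)
  next
    case False
    then have "a p = a q"
      using that by (simp add: f_def)
    then have "q \<in> partner_class X d p"
      using partner_class_eq[of "a p" p] partner_class_sym[of "a q" q] a[OF that(1)] a[OF that(2)]
        partner_class_trans[of "a q" p q] by simp
    then show ?thesis
      using False generator_meets_partners[OF T, of p q] by (auto simp: partner_class_def)
  qed
  ultimately show ?thesis
    unfolding lepoll_def by (intro exI[of _ f]) (auto simp: inj_on_def)
qed

lemma omits_one_irredundant:
  assumes S: "omits_one_per_class X d S" and T: "T \<subset> S"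
  shows "\<not> metric_generator X d T"
proof
  assume gen: "metric_generator X d T"
  obtain p where p: "p \<in> S" "p \<notin> T"
    using T by auto
  then obtain a where a: "a \<in> partner_class X d p" "a \<notin> S"
    using S unfolding omits_one_per_class_def by blast
  then have "partners X d p a"
    using p by (auto simp: partner_class_def)
  then show False
    using generator_meets_partners[OF gen] a p T by blast
qed

lemma generator_contains_omits_one:
  assumes T: "metric_generator X d T"
  shows "\<exists>S\<subseteq>T. omits_one_per_class X d S"
proof -
  \<comment> \<open>The point to omit from C is the one that T omits, or an arbitrary one if T contains C.\<close>
  define a where "a C = (SOME a. a \<in> C \<and> C - {a} \<subseteq> T)" for C
  have a: "a C \<in> C \<and> C - {a C} \<subseteq> T" if C: "C = partner_class X d p" for C p
  proof -
    have "\<exists>a. a \<in> C \<and> C - {a} \<subseteq> T"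
    proof (cases "C \<subseteq> T")
      case True
      then show ?thesis using self_in_partner_class C by blast
    next
      case False
      then obtain b where "b \<in> C" "b \<notin> T" by auto
      then have "C - {b} \<subseteq> T"
        using generator_meets_partners[OF T] partners_in_class C by blast
      with \<open>b \<in> C\<close> show ?thesis by blast
    qed
    then show ?thesis unfolding a_def by (rule someI_ex)
  qed
  define S where "S = {p \<in> partnered_points X d. p \<noteq> a (partner_class X d p)}"
  have "S \<subseteq> T"
    using a self_in_partner_class unfolding S_def by blast
  moreover have "omits_one_per_class X d S"
    unfolding omits_one_per_class_def
  proof (intro conjI ballI)
    fix p assume p: "p \<in> partnered_points X d"
    let ?C = "partner_class X d p"
    have "b \<in> S \<longleftrightarrow> b \<noteq> a ?C" if "b \<in> ?C" for b
      using that p partner_class_partnered partner_class_eq by (simp add: S_def)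
    then show "\<exists>!b. b \<in> ?C \<and> b \<notin> S"
      using a[OF refl] by blast
  qed (simp add: S_def)
  ultimately show ?thesis by blast
qed

lemma metric_basis_iff_omits_one:
  assumes "pseudo_complete X d" and "\<not> (\<exists>p. unpartnered X d p)"
  shows "metric_basis X d S \<longleftrightarrow> omits_one_per_class X d S"
proof
  assume S: "metric_basis X d S"
  then obtain S' where "S' \<subseteq> S" "omits_one_per_class X d S'"
    using generator_contains_omits_one[of S]
    by (auto simp: metric_basis_def minimum_cardinality_generator_def)
  moreover from this have "S' = S"
    using S omits_one_generates[OF assms] unfolding metric_basis_def by blast
  ultimately show "omits_one_per_class X d S"
    by simp
next
  assume "omits_one_per_class X d S"
  then show "metric_basis X d S"
    using omits_one_generates[OF assms] omits_one_lepoll_generator omits_one_irredundant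
    unfolding metric_basis_def minimum_cardinality_generator_def by blast
qed

lemma omits_one_iff_choice:
  assumes xP: "\<forall>i\<in>I. x i \<in> partnered_points X d"
    and bij: "bij_betw (\<lambda>i. partner_class X d (x i)) I (partner_classes X d)"
  shows "omits_one_per_class X d S \<longleftrightarrow>
    (\<exists>\<alpha> \<in> (\<Pi>\<^sub>E i\<in>I. partner_class X d (x i)).
       S = (\<Union>i\<in>I. partner_class X d (x i) - {\<alpha> i}))"
    (is "_ \<longleftrightarrow> (\<exists>\<alpha> \<in> Pi\<^sub>E I ?C. _)")
proof
  have index: "\<exists>i\<in>I. partner_class X d p = ?C i" if "p \<in> partnered_points X d" for p
  proof -
    have "partner_class X d p \<in> ?C ` I"
      using bij_betw_imp_surj_on[OF bij] partner_classes_eq that by blast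
    then show ?thesis by blast
  qed
  have same: "i = j" if "i \<in> I" "j \<in> I" "p \<in> ?C i" "p \<in> ?C j" for i j p
  proof -
    have "?C i = ?C j"
      using partner_class_eq[OF that(3)] partner_class_eq[OF that(4)] by simp
    then show ?thesis
      using inj_onD[OF bij_betw_imp_inj_on[OF bij]] that(1,2) by blast
  qed
  {
    assume S: "omits_one_per_class X d S"
    define \<alpha> where "\<alpha> = (\<lambda>i\<in>I. THE a. a \<in> ?C i \<and> a \<notin> S)"
    have ex1: "\<exists>!a. a \<in> ?C i \<and> a \<notin> S" if "i \<in> I" for i
      using S xP that by (auto simp: omits_one_per_class_def)
    have \<alpha>: "\<alpha> i \<in> ?C i \<and> \<alpha> i \<notin> S" if "i \<in> I" for i
      using theI'[OF ex1[OF that]] that by (simp add: \<alpha>_def)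
    have "\<alpha> \<in> Pi\<^sub>E I ?C"
      using \<alpha> by (auto simp: \<alpha>_def)
    moreover have "S = (\<Union>i\<in>I. ?C i - {\<alpha> i})"
    proof
      show "S \<subseteq> (\<Union>i\<in>I. ?C i - {\<alpha> i})"
      proof
        fix p assume p: "p \<in> S"
        then have "p \<in> partnered_points X d"
          using S by (auto simp: omits_one_per_class_def)
        then obtain i where "i \<in> I" "p \<in> ?C i"
          using index self_in_partner_class by blast
        with \<alpha> p show "p \<in> (\<Union>i\<in>I. ?C i - {\<alpha> i})"
          by blast
      qed
      show "(\<Union>i\<in>I. ?C i - {\<alpha> i}) \<subseteq> S"
        using \<alpha> ex1 by blast
    qed
    ultimately show "\<exists>\<alpha> \<in> Pi\<^sub>E I ?C. S = (\<Union>i\<in>I. ?C i - {\<alpha> i})"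
      by blast
  }
  assume "\<exists>\<alpha> \<in> Pi\<^sub>E I ?C. S = (\<Union>i\<in>I. ?C i - {\<alpha> i})"
  then obtain \<alpha> where \<alpha>: "\<And>i. i \<in> I \<Longrightarrow> \<alpha> i \<in> ?C i" and S: "S = (\<Union>i\<in>I. ?C i - {\<alpha> i})"
    by (auto simp: PiE_def Pi_def)
  show "omits_one_per_class X d S"
    unfolding omits_one_per_class_def
  proof (intro conjI ballI)
    show "S \<subseteq> partnered_points X d"
      using S xP partner_class_partnered by blast
    fix p assume "p \<in> partnered_points X d"
    then obtain i where i: "i \<in> I" "partner_class X d p = ?C i"
      using index by blast
    have "b \<in> S \<longleftrightarrow> b \<noteq> \<alpha> i" if "b \<in> ?C i" for b
      using S same i(1) that by blast
    with \<alpha>[OF i(1)] show "\<exists>!a. a \<in> partner_class X d p \<and> a \<notin> S"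
      unfolding i(2) by blast
  qed
qed

end

theorem theorem2p33:
  fixes X :: "'a set" and d :: "'a \<Rightarrow> 'a \<Rightarrow> real"
    and I :: "'i set" and x :: "'i \<Rightarrow> 'a" and S :: "'a set"
  assumes "ultrametric_space X d"
    and "pseudo_complete X d"
    and "\<exists>p\<in>X. \<exists>q\<in>X. p \<noteq> q"
    and "\<not> (\<exists>p. unpartnered X d p)"
    and "\<forall>i\<in>I. x i \<in> partnered_points X d"
    and "bij_betw (\<lambda>i. partner_class X d (x i)) I (partner_classes X d)"
    and "S \<subseteq> X"
  shows "metric_basis X d S \<longleftrightarrow>
    (\<exists>\<alpha> \<in> (\<Pi>\<^sub>E i\<in>I. partner_class X d (x i)).
       S = (\<Union>i\<in>I. partner_class X d (x i) - {\<alpha> i}))"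
proof -
  interpret ultrametric_space X d by fact
  show ?thesis
    using metric_basis_iff_omits_one[OF assms(2,4)] omits_one_iff_choice[OF assms(5,6)] by simp
qed

end
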